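(* Consider the linear network model with latent agents, observed through the data $\{(p_O^{(t)},y_O^{(t)})\}_{t\in[n]}$, with diagonally dominant $M$. Suppose that $M=XDX^{-1}$ and $M_{LL}=YD_{LL}Y^{-1}$ with $D,D_{LL}$ diagonal, $X,Y$ invertible and $\kappa(X),\kappa(Y)\le\bar\kappa$ for a constant $\bar\kappa$. Let $r=(2\bar\lambda-\zeta)/\zeta$, $q=(\sqrt r-1)/(\sqrt r+1)$. Let $\check W$ and $\check W^\mu$ be the debiased and thresholded estimators defined in the context, with thresholds satisfying $2|\check W_{kj}-(H^{-1})_{kj}|\le\mu_{kj}\le C_1\sqrt{\log|V_O|/n}$ for all $k,j\in V_O$ and a constant $C_1$. (i) Suppose neighborhoods exhibit exponential growth with constants $C_e,d_e$, let $\nu=\log_{d_e/q}(d_e)$, and suppose the design is regular with respect to $s_n=\tilde C_1\big(\frac{\sqrt{n|V_O|}}{\log|V_O|}\big)^\nu$, $r_{1n}=\tilde C_2|V_O|^{\nu/2}\big(\frac{\log|V_O|}{\sqrt n}\big)^{1-\nu}$ for some constants $\tilde C_1,\tilde C_2>0$. Then with probability $1-o(1)$ $$\max\{\|\check W^\mu-H^{-1}\|_\infty,\|\check W^\mu-H^{-1}\|_1\}\le\tilde C_5\sqrt{\frac{\log|V_O|}n}\Big(\frac{\sqrt{n|V_O|}}{\log|V_O|}\Big)^\nu+\tilde C_6|V_O|^{\nu/2}\Big(\frac{\log|V_O|}{\sqrt n}\Big)^{1-\nu}$$ for some constants $\tilde C_5,\tilde C_6>0$. (ii) Suppose neighborhoods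 exhibit polynomial growth with constants $C_p,d_p$, and suppose the design is regular with respect to $s_n=\tilde C_3\big(\frac n{\log|V_O|}\big)^{1/4}$, $r_{1n}=\tilde C_4\sqrt{|V_O|}\,q^{(n/\log|V_O|)^{1/(4d_p)}}$ for some constants $\tilde C_3,\tilde C_4>0$. Then with probability $1-o(1)$ $$\max\{\|\check W^\mu-H^{-1}\|_\infty,\|\check W^\mu-H^{-1}\|_1\}\le\tilde C_7\sqrt[4]{\frac{\log|V_O|}n}+\tilde C_8\sqrt{|V_O|}\;q^{\left(\frac n{\log|V_O|}\right)^{1/(4d_p)}}$$ for some constants $\tilde C_7,\tilde C_8>0$.
   Context: **Asymptotics.** $n$ is the number of periods, $[n]=\{1,\dots,n\}$; limits are as $n\to\infty$. The network, its sizes, all model parameters, the data distribution, $s_n,r_{1n},M_\varepsilon,M_\Psi$ may depend on $n$. A "constant" is a number not depending on $n$ or on the network sizes. **Model.** $V=V_O\sqcup V_L$ is a finite set of agents (observable and latent) with directed edges $E\subset V\times V$, $G\in\mathbb R_{\ge0}^{V\times V}$ the weights ($G_{ij}=0$ if $(i,j)\notin E$), $\Lambda=\mathrm{diag}(\lambda_i)_{i\in V}$, $M=\Lambda-G$. Outcomes in period $t$ are $y^{(t)}=M^{-1}(a+\xi^{(t)}-p^{(t)})$, with intercepts $a\in\mathbb R^V$, covariates $p^{(t)}\in\mathbb R^V$ and zero-mean shocks $\xi^{(t)}$, independent over $t$ (possibly correlated across agents). Latent covariates are fixed: $p^{(t)}_i=p_0$ for $i\in V_L$. Subscripts $O,L$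 denote sub-vectors/blocks for $V_O,V_L$. Put $S_{OL}=M_{OL}M_{LL}^{-1}$, $H=M_{OO}-M_{OL}M_{LL}^{-1}M_{LO}$, $v_O=H^{-1}a_O-H^{-1}S_{OL}(a_L-p_L)$, $\varepsilon_O^{(t)}=H^{-1}\xi_O^{(t)}-H^{-1}S_{OL}\xi_L^{(t)}$, so that $$y_O^{(t)}=v_O-H^{-1}p_O^{(t)}+\varepsilon_O^{(t)}.\qquad( * )$$ Standing assumptions: $|a_i|\le\bar a$, $|\lambda_i|\le\bar\lambda$, $|p_i^{(t)}|\le\bar p$ for all $i,t$ with constants $\bar a,\bar\lambda,\bar p$; and (diagonal dominance) there is a constant $\zeta>0$, $\zeta<\bar\lambda$, with $\lambda_i\ge\sum_jG_{ij}+\zeta$ and $\lambda_i\ge\sum_jG_{ji}+\zeta$ for all $i$. Only $\{(p_O^{(t)},y_O^{(t)})\}$ is observed. $\kappa(A)=\|A\|_2\|A^{-1}\|_2$. **Neighborhood growth.** $\rho(i,j)$ is the minimum number of edges on a directed path from $i$ to $j$ in $(V,E)$ ($\rho(i,i)=0$, $\rho(i,j)=\infty$ if there is no path). Neighborhoods exhibit exponential growth with constants $C_e,d_e>0$ if $|\{j:\rho(i,j)\le k\}\cup\{j:\rho(j,i)\le k\}|\le C_ed_e^k$ for all $i\in V$ and integers $k\ge0$; polynomial growth with constants $C_p,d_p>0$ if $|\{j:\rho(i,j)\le k\}\cup\{j:\rho(j,i)\le k\}|\le C_pk^{d_p}$ for all $i\in V$ and integers $k\ge1$. **Norms and indices.**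 $\|A\|_1,\|A\|_\infty$ are the maximum absolute column and row sums; $A_{k,\cdot}$ and $A_{\cdot,k}$ the $k$th row and column. $\bar V_O=\{0\}\cup V_O$; $(1;p_O^{(t)})\in\mathbb R^{\bar V_O}$ has $0$th entry $1$ and $j$th entry $p_j^{(t)}$. $\mathbf 1_{kj}=1$ if $k=j$, else $0$. $\Phi$ is the standard normal CDF. **Sparse approximation.** A matrix is $s$-sparse if each row and each column has at most $s$ nonzero entries. $H^{-1}$ admits an $(s,r_1)$-sparse approximation if there is an $s$-sparse $\bar W$ with $\max\{\|H^{-1}-\bar W\|_1,\|H^{-1}-\bar W\|_\infty\}\le r_1$. **Regular design.** The design is regular with respect to $(s_n,r_{1n})$ if $H^{-1}$ admits an $(s_n,r_{1n})$-sparse approximation and, for constants $0<c<C$, $C'>0$ and parameters $M_\varepsilon,M_\Psi\ge1$: 1. the data $(p_O^{(t)},y_O^{(t)})$, $t\in[n]$, are i.i.d. and satisfy $( * )$, and $E[\varepsilon_O^{(t)}\mid p_O^{(t)}]=0$; 2. for all $t$: $\min_{j\in V_O}E[(\varepsilon_j^{(t)})^2\mid p_O^{(t)}]\ge c$, $\max_{j\in V_O}E[|\varepsilon_j^{(t)}|^4\mid p_O^{(t)}]\le C$, and $E[\max_{t\in[n],j\in V_O}|\varepsilon_j^{(t)}|^4\mid\{p_O^{(t)}\}]\le M_\varepsilon$; 3. $\bar\Psi:=E[(1;p_O^{(t)})(1;p_O^{(t)})^T]^{-1}$ satisfies $\min_{k,j\in\bar V_O}E[\{\bar\Psi_{k,\cdot}(1;p_O^{(t)})(1;p_O^{(t)})_j-\mathbf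 1_{kj}\}^2]\ge c$, $\max_{k,j\in\bar V_O}E[|\bar\Psi_{k,\cdot}(1;p_O^{(t)})(1;p_O^{(t)})_j|^4]\le C$, $E[\max_{t\in[n];j,k\in\bar V_O}|\bar\Psi_{k,\cdot}(1;p_O^{(t)})(1;p_O^{(t)})_j|^4]\le M_\Psi$, and the eigenvalues of $\bar\Psi$ are bounded above by a constant; 4. $s_n^2(\log|V_O|)(\log n)^3=o(n)$, $M_\varepsilon M_\Psi\log|V_O|=o(n)$, $C'\log|V_O|\ge\log n$. **Estimators.** Put $M_n^2=1\vee\max_{k\in V_O}\frac1n\sum_t(p_k^{(t)})^4$, $\tau=\frac1{4M_n}$, $\lambda=\frac1{\sqrt n}\Phi^{-1}\big(1-\frac1{3n|V_O|^2}\big)$, $\hat\Sigma=\frac1n\sum_t(1;p_O^{(t)})(1;p_O^{(t)})^T$. Step 1: $(\hat W,\hat v,\hat z)$ minimizes $\sum_{k\in V_O}\big(\|(\tilde v_k,\tilde W_{k,\cdot})\|_1+\tau z_k\big)$ over $(\tilde W,\tilde v,z)$ subject to, for all $k\in V_O$, $j\in\bar V_O$: $\big|\frac1n\sum_t\{y_k^{(t)}-(\tilde v_k-\tilde W_{k,\cdot}p_O^{(t)})\}(1;p_O^{(t)})_j\big|\le\lambda z_k$ and $\big\{\frac1n\sum_t\{y_k^{(t)}-(\tilde v_k-\tilde W_{k,\cdot}p_O^{(t)})\}^2(1;p_O^{(t)})_j^2\big\}^{1/2}\le z_k$. Step 2: $\hat\Psi\in\mathbb R^{\bar V_O\times\bar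 V_O}$ is the $\Psi$-part of a minimizer of $\sum_{k\in\bar V_O}\big\{\big(\frac1n\sum_t|\Psi_{k,\cdot}(1;p_O^{(t)})|^4\big)^{1/4}+z_k\big\}$ over $(z,\Psi)$ subject to, for all $k,j\in\bar V_O$: $|\Psi_{k,\cdot}\hat\Sigma_{\cdot,j}-\mathbf 1_{kj}|\le\lambda z_k$ and $\big\{\frac1n\sum_t\{\Psi_{k,\cdot}(1;p_O^{(t)})(1;p_O^{(t)})_j-\mathbf 1_{kj}\}^2\big\}^{1/2}\le z_k$. Step 3 (debiased estimator): $(-\check v^T;\check W^T)=(-\hat v^T;\hat W^T)-\hat\Psi\big\{\frac1n\sum_t(1;p_O^{(t)})\{y_O^{(t)}-(\hat v-\hat Wp_O^{(t)})\}^T\big\}$. Step 4 (thresholded estimator, for thresholds $\mu_{kj}$): $\check W^\mu_{kj}=\check W_{kj}\,1\{|\check W_{kj}|>\mu_{kj}\}$, $k,j\in V_O$. *)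

theory Defs
  imports "HOL-Probability.Probability" "HOL-Library.Landau_Symbols" "HOL-Library.Extended_Nat"
begin

section \<open>Matrices and vectors over finite index sets\<close>

text \<open>
  The index sets vary with the number of periods, so a matrix is a function of two indices together
  with explicit finite carriers. A sub-block such as the observable-latent one is the same function
  with its indices ranging over the corresponding carriers.
\<close>

definition mvec :: "'j set \<Rightarrow> ('i \<Rightarrow> 'j \<Rightarrow> 'b::semiring_0) \<Rightarrow> ('j \<Rightarrow> 'b) \<Rightarrow> 'i \<Rightarrow> 'b" where
  "mvec J A x i = (\<Sum>j\<in>J. A i j * x j)"

definition mmul :: "'j set \<Rightarrow> ('i \<Rightarrow> 'j \<Rightarrow> 'b::semiring_0) \<Rightarrow> ('j \<Rightarrow> 'k \<Rightarrow> 'b) \<Rightarrow> 'i \<Rightarrow> 'k \<Rightarrow> 'b" where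
  "mmul J A B i k = (\<Sum>j\<in>J. A i j * B j k)"

definition mdiag :: "('i \<Rightarrow> 'b::zero) \<Rightarrow> 'i \<Rightarrow> 'i \<Rightarrow> 'b" where
  "mdiag d i j = (if i = j then d i else 0)"

definition is_minv :: "'i set \<Rightarrow> ('i \<Rightarrow> 'i \<Rightarrow> 'b::field) \<Rightarrow> ('i \<Rightarrow> 'i \<Rightarrow> 'b) \<Rightarrow> bool" where
  "is_minv I A B \<longleftrightarrow>
     (\<forall>i\<in>I. \<forall>j\<in>I. mmul I A B i j = (if i = j then 1 else 0) \<and>
                   mmul I B A i j = (if i = j then 1 else 0))"

definition minvertible :: "'i set \<Rightarrow> ('i \<Rightarrow> 'i \<Rightarrow> 'b::field) \<Rightarrow> bool" where
  "minvertible I A \<longleftrightarrow> (\<exists>B. is_minv I A B)"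

text \<open>The entries outside the carrier are set to zero so that the inverse is a unique function.\<close>

definition minv :: "'i set \<Rightarrow> ('i \<Rightarrow> 'i \<Rightarrow> 'b::field) \<Rightarrow> 'i \<Rightarrow> 'i \<Rightarrow> 'b" where
  "minv I A = (THE B. is_minv I A B \<and> (\<forall>i j. i \<notin> I \<or> j \<notin> I \<longrightarrow> B i j = 0))"

text \<open>In the next two norms the inserted \<open>0\<close> only matters for an empty carrier.\<close>

definition mnorm_1 :: "'i set \<Rightarrow> ('i \<Rightarrow> 'i \<Rightarrow> real) \<Rightarrow> real" where
  "mnorm_1 I A = Max (insert 0 ((\<lambda>j. \<Sum>i\<in>I. \<bar>A i j\<bar>) ` I))"

definition mnorm_inf :: "'i set \<Rightarrow> ('i \<Rightarrow> 'i \<Rightarrow> real) \<Rightarrow> real" where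
  "mnorm_inf I A = Max (insert 0 ((\<lambda>i. \<Sum>j\<in>I. \<bar>A i j\<bar>) ` I))"

definition mnorm_2 :: "'i set \<Rightarrow> ('i \<Rightarrow> 'i \<Rightarrow> 'b::real_normed_field) \<Rightarrow> real" where
  "mnorm_2 I A =
     (SUP x \<in> {x. L2_set (\<lambda>i. norm (x i)) I \<le> 1}. L2_set (\<lambda>i. norm (mvec I A x i)) I)"

definition mcond :: "'i set \<Rightarrow> ('i \<Rightarrow> 'i \<Rightarrow> 'b::real_normed_field) \<Rightarrow> real" where
  "mcond I A = mnorm_2 I A * mnorm_2 I (minv I A)"

text \<open>
  A real matrix that need not be symmetric is diagonalized over the complex numbers. A real
  diagonalization is a special case: a real matrix has the same spectral norm on the real and on
  the complex vector space.
\<close>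

definition diagonalizable_cond :: "'i set \<Rightarrow> ('i \<Rightarrow> 'i \<Rightarrow> real) \<Rightarrow> real \<Rightarrow> bool" where
  "diagonalizable_cond I A \<kappa> \<longleftrightarrow>
     (\<exists>(X :: 'i \<Rightarrow> 'i \<Rightarrow> complex) d. minvertible I X \<and>
        (\<forall>i\<in>I. \<forall>j\<in>I. complex_of_real (A i j) = mmul I (mmul I X (mdiag d)) (minv I X) i j) \<and>
        mcond I X \<le> \<kappa>)"

definition meigenvalue :: "'i set \<Rightarrow> ('i \<Rightarrow> 'i \<Rightarrow> real) \<Rightarrow> real \<Rightarrow> bool" where
  "meigenvalue I A \<theta> \<longleftrightarrow>
     (\<exists>u. (\<exists>k\<in>I. u k \<noteq> 0) \<and> (\<forall>k\<in>I. mvec I A u k = \<theta> * u k))"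

definition sparse_mat :: "'i set \<Rightarrow> real \<Rightarrow> ('i \<Rightarrow> 'i \<Rightarrow> real) \<Rightarrow> bool" where
  "sparse_mat I s A \<longleftrightarrow>
     (\<forall>i\<in>I. real (card {j\<in>I. A i j \<noteq> 0}) \<le> s) \<and> (\<forall>j\<in>I. real (card {i\<in>I. A i j \<noteq> 0}) \<le> s)"

definition sparse_approx :: "'i set \<Rightarrow> ('i \<Rightarrow> 'i \<Rightarrow> real) \<Rightarrow> real \<Rightarrow> real \<Rightarrow> bool" where
  "sparse_approx I A s r1 \<longleftrightarrow>
     (\<exists>W. sparse_mat I s W \<and>
          max (mnorm_1 I (\<lambda>i j. A i j - W i j)) (mnorm_inf I (\<lambda>i j. A i j - W i j)) \<le> r1)"


section \<open>Networks with latent agents\<close>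

record 'v network =
  obs :: "'v set"
  lat :: "'v set"
  edges :: "('v \<times> 'v) set"
  weight :: "'v \<Rightarrow> 'v \<Rightarrow> real"
  lam :: "'v \<Rightarrow> real"
  icept :: "'v \<Rightarrow> real"
  latcov :: real \<comment> \<open>the common fixed covariate of the latent agents\<close>

definition agents :: "'v network \<Rightarrow> 'v set" where
  "agents N = obs N \<union> lat N"

definition Mmat :: "'v network \<Rightarrow> 'v \<Rightarrow> 'v \<Rightarrow> real" where
  "Mmat N i j = mdiag (lam N) i j - weight N i j"

definition Smat :: "'v network \<Rightarrow> 'v \<Rightarrow> 'v \<Rightarrow> real" where
  "Smat N = mmul (lat N) (Mmat N) (minv (lat N) (Mmat N))"

definition Hmat :: "'v network \<Rightarrow> 'v \<Rightarrow> 'v \<Rightarrow> real" where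
  "Hmat N i j = Mmat N i j - mmul (lat N) (Smat N) (Mmat N) i j"

definition Hinv :: "'v network \<Rightarrow> 'v \<Rightarrow> 'v \<Rightarrow> real" where
  "Hinv N = minv (obs N) (Hmat N)"

definition v_obs :: "'v network \<Rightarrow> 'v \<Rightarrow> real" where
  "v_obs N i = mvec (obs N) (Hinv N) (icept N) i
     - mvec (obs N) (Hinv N) (mvec (lat N) (Smat N) (\<lambda>l. icept N l - latcov N)) i"

definition eps_obs :: "'v network \<Rightarrow> ('v \<Rightarrow> real) \<Rightarrow> 'v \<Rightarrow> real" where
  "eps_obs N \<xi> i = mvec (obs N) (Hinv N) \<xi> i
     - mvec (obs N) (Hinv N) (mvec (lat N) (Smat N) \<xi>) i"

definition outcome :: "'v network \<Rightarrow> ('v \<Rightarrow> real) \<Rightarrow> ('v \<Rightarrow> real) \<Rightarrow> 'v \<Rightarrow> real" where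
  "outcome N p \<xi> = mvec (agents N) (minv (agents N) (Mmat N)) (\<lambda>j. icept N j + \<xi> j - p j)"

definition network_ok :: "real \<Rightarrow> real \<Rightarrow> real \<Rightarrow> 'v network \<Rightarrow> bool" where
  "network_ok abar lambar \<zeta> N \<longleftrightarrow>
     finite (agents N) \<and> obs N \<inter> lat N = {} \<and> edges N \<subseteq> agents N \<times> agents N \<and>
     (\<forall>i\<in>agents N. \<forall>j\<in>agents N.
        weight N i j \<ge> 0 \<and> ((i, j) \<notin> edges N \<longrightarrow> weight N i j = 0)) \<and>
     (\<forall>i\<in>agents N. \<bar>icept N i\<bar> \<le> abar \<and> \<bar>lam N i\<bar> \<le> lambar \<and>
        lam N i \<ge> (\<Sum>j\<in>agents N. weight N i j) + \<zeta> \<and>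
        lam N i \<ge> (\<Sum>j\<in>agents N. weight N j i) + \<zeta>)"

definition net_dist :: "'v network \<Rightarrow> 'v \<Rightarrow> 'v \<Rightarrow> enat" where
  "net_dist N i j = (INF k \<in> {k. (i, j) \<in> edges N ^^ k}. enat k)"

definition neighborhood :: "'v network \<Rightarrow> 'v \<Rightarrow> nat \<Rightarrow> 'v set" where
  "neighborhood N i k =
     {j \<in> agents N. net_dist N i j \<le> enat k} \<union> {j \<in> agents N. net_dist N j i \<le> enat k}"

definition exp_growth :: "real \<Rightarrow> real \<Rightarrow> 'v network \<Rightarrow> bool" where
  "exp_growth Ce de N \<longleftrightarrow>
     (\<forall>i\<in>agents N. \<forall>k. real (card (neighborhood N i k)) \<le> Ce * de ^ k)"

definition poly_growth :: "real \<Rightarrow> real \<Rightarrow> 'v network \<Rightarrow> bool" where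
  "poly_growth Cp dp N \<longleftrightarrow>
     (\<forall>i\<in>agents N. \<forall>k\<ge>1. real (card (neighborhood N i k)) \<le> Cp * real k powr dp)"


section \<open>The random model\<close>

text \<open>
  The covariates and shocks have type \<open>nat \<Rightarrow> 'w \<Rightarrow> 'v \<Rightarrow> real\<close> (period, sample point, agent); the
  periods are \<open>{1..n}\<close>.
\<close>

definition rvec :: "'w measure \<Rightarrow> 'v set \<Rightarrow> ('w \<Rightarrow> 'v \<Rightarrow> real) \<Rightarrow> bool" where
  "rvec P I X \<longleftrightarrow> (\<forall>i\<in>I. (\<lambda>\<omega>. X \<omega> i) \<in> borel_measurable P)"

definition model ::
  "real \<Rightarrow> 'w measure \<Rightarrow> 'v network \<Rightarrow> nat \<Rightarrow> (nat \<Rightarrow> 'w \<Rightarrow> 'v \<Rightarrow> real) \<Rightarrow> (nat \<Rightarrow> 'w \<Rightarrow> 'v \<Rightarrow> real) \<Rightarrow> bool"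
where
  "model pbar P N n p \<xi> \<longleftrightarrow>
     prob_space P \<and>
     (\<forall>t\<in>{1..n}. rvec P (agents N) (p t) \<and> rvec P (agents N) (\<xi> t)) \<and>
     (\<forall>t\<in>{1..n}. \<forall>\<omega>\<in>space P. \<forall>i\<in>lat N. p t \<omega> i = latcov N) \<and>
     (\<forall>t\<in>{1..n}. AE \<omega> in P. \<forall>i\<in>agents N. \<bar>p t \<omega> i\<bar> \<le> pbar) \<and>
     (\<forall>t\<in>{1..n}. \<forall>i\<in>agents N. integrable P (\<lambda>\<omega>. \<xi> t \<omega> i) \<and> (\<integral>\<omega>. \<xi> t \<omega> i \<partial>P) = 0) \<and>
     prob_space.indep_vars P (\<lambda>_. PiM (agents N) (\<lambda>_. borel))
       (\<lambda>t \<omega>. restrict (\<xi> t \<omega>) (agents N)) {1..n}"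

text \<open>The index \<open>None\<close> plays the role of the additional index 0 of the intercept.\<close>

definition Vbar :: "'v network \<Rightarrow> 'v option set" where
  "Vbar N = insert None (Some ` obs N)"

definition aug :: "('v \<Rightarrow> real) \<Rightarrow> 'v option \<Rightarrow> real" where
  "aug p = case_option 1 p"

definition data_space :: "'v network \<Rightarrow> (('v \<Rightarrow> real) \<times> ('v \<Rightarrow> real)) measure" where
  "data_space N = PiM (obs N) (\<lambda>_. borel) \<Otimes>\<^sub>M PiM (obs N) (\<lambda>_. borel)"

definition data ::
  "'v network \<Rightarrow> (nat \<Rightarrow> 'w \<Rightarrow> 'v \<Rightarrow> real) \<Rightarrow> (nat \<Rightarrow> 'w \<Rightarrow> 'v \<Rightarrow> real) \<Rightarrow> nat \<Rightarrow> 'w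
     \<Rightarrow> ('v \<Rightarrow> real) \<times> ('v \<Rightarrow> real)" where
  "data N p \<xi> t \<omega> = (restrict (p t \<omega>) (obs N), restrict (outcome N (p t \<omega>) (\<xi> t \<omega>)) (obs N))"

text \<open>The sigma-algebra generated by the observable covariates of the periods in \<open>T\<close>.\<close>

definition sigma_p :: "'w measure \<Rightarrow> 'v network \<Rightarrow> (nat \<Rightarrow> 'w \<Rightarrow> 'v \<Rightarrow> real) \<Rightarrow> nat set \<Rightarrow> 'w measure"
where
  "sigma_p P N p T = vimage_algebra (space P)
     (\<lambda>\<omega>. \<lambda>t\<in>T. restrict (p t \<omega>) (obs N)) (PiM T (\<lambda>_. PiM (obs N) (\<lambda>_. borel)))"

text \<open>
  The design matrix and its inverse are formed from period 1; under identically distributed data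
  every period gives the same matrix.
\<close>

definition second_moment ::
  "'w measure \<Rightarrow> (nat \<Rightarrow> 'w \<Rightarrow> 'v \<Rightarrow> real) \<Rightarrow> 'v option \<Rightarrow> 'v option \<Rightarrow> real" where
  "second_moment P p k j = (\<integral>\<omega>. aug (p 1 \<omega>) k * aug (p 1 \<omega>) j \<partial>P)"

definition Psibar ::
  "'w measure \<Rightarrow> 'v network \<Rightarrow> (nat \<Rightarrow> 'w \<Rightarrow> 'v \<Rightarrow> real) \<Rightarrow> 'v option \<Rightarrow> 'v option \<Rightarrow> real" where
  "Psibar P N p = minv (Vbar N) (second_moment P p)"

definition psi_x ::
  "'w measure \<Rightarrow> 'v network \<Rightarrow> (nat \<Rightarrow> 'w \<Rightarrow> 'v \<Rightarrow> real) \<Rightarrow> nat \<Rightarrow> 'w \<Rightarrow> 'v option \<Rightarrow> 'v option \<Rightarrow> real"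
where
  "psi_x P N p t \<omega> k j = mvec (Vbar N) (Psibar P N p) (aug (p t \<omega>)) k * aug (p t \<omega>) j"


section \<open>Regular designs\<close>

definition design_data ::
  "'w measure \<Rightarrow> 'v network \<Rightarrow> nat \<Rightarrow> (nat \<Rightarrow> 'w \<Rightarrow> 'v \<Rightarrow> real) \<Rightarrow> (nat \<Rightarrow> 'w \<Rightarrow> 'v \<Rightarrow> real) \<Rightarrow> bool" where
  "design_data P N n p \<xi> \<longleftrightarrow>
     prob_space.indep_vars P (\<lambda>_. data_space N) (data N p \<xi>) {1..n} \<and>
     (\<forall>t\<in>{1..n}. \<forall>u\<in>{1..n}.
        distr P (data_space N) (data N p \<xi> t) = distr P (data_space N) (data N p \<xi> u)) \<and>
     (\<forall>t\<in>{1..n}. \<forall>\<omega>\<in>space P. \<forall>i\<in>obs N.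
        outcome N (p t \<omega>) (\<xi> t \<omega>) i
          = v_obs N i - mvec (obs N) (Hinv N) (p t \<omega>) i + eps_obs N (\<xi> t \<omega>) i) \<and>
     (\<forall>t\<in>{1..n}. \<forall>j\<in>obs N.
        AE \<omega> in P. real_cond_exp P (sigma_p P N p {t}) (\<lambda>\<omega>. eps_obs N (\<xi> t \<omega>) j) \<omega> = 0)"

text \<open>
  Moments of nonnegative variables are taken in \<open>ennreal\<close>, so that an upper bound includes
  finiteness and a lower bound admits the value infinity. The suprema range over finite sets, so
  they are the maxima.
\<close>

definition design_noise ::
  "real \<Rightarrow> real \<Rightarrow> real \<Rightarrow> 'w measure \<Rightarrow> 'v network \<Rightarrow> nat
     \<Rightarrow> (nat \<Rightarrow> 'w \<Rightarrow> 'v \<Rightarrow> real) \<Rightarrow> (nat \<Rightarrow> 'w \<Rightarrow> 'v \<Rightarrow> real) \<Rightarrow> bool" where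
  "design_noise c C Meps P N n p \<xi> \<longleftrightarrow>
     (\<forall>t\<in>{1..n}. \<forall>j\<in>obs N. AE \<omega> in P.
        nn_cond_exp P (sigma_p P N p {t}) (\<lambda>\<omega>. ennreal ((eps_obs N (\<xi> t \<omega>) j)\<^sup>2)) \<omega> \<ge> ennreal c) \<and>
     (\<forall>t\<in>{1..n}. \<forall>j\<in>obs N. AE \<omega> in P.
        nn_cond_exp P (sigma_p P N p {t}) (\<lambda>\<omega>. ennreal (\<bar>eps_obs N (\<xi> t \<omega>) j\<bar> ^ 4)) \<omega> \<le> ennreal C) \<and>
     (AE \<omega> in P.
        nn_cond_exp P (sigma_p P N p {1..n})
          (\<lambda>\<omega>. SUP t\<in>{1..n}. SUP j\<in>obs N. ennreal (\<bar>eps_obs N (\<xi> t \<omega>) j\<bar> ^ 4)) \<omega> \<le> ennreal Meps)"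

definition design_covariates ::
  "real \<Rightarrow> real \<Rightarrow> real \<Rightarrow> real \<Rightarrow> 'w measure \<Rightarrow> 'v network \<Rightarrow> nat
     \<Rightarrow> (nat \<Rightarrow> 'w \<Rightarrow> 'v \<Rightarrow> real) \<Rightarrow> bool" where
  "design_covariates c C K MPsi P N n p \<longleftrightarrow>
     minvertible (Vbar N) (second_moment P p) \<and>
     (\<forall>t\<in>{1..n}. \<forall>k\<in>Vbar N. \<forall>j\<in>Vbar N.
        (\<integral>\<^sup>+\<omega>. ennreal ((psi_x P N p t \<omega> k j - (if k = j then 1 else 0))\<^sup>2) \<partial>P) \<ge> ennreal c) \<and>
     (\<forall>t\<in>{1..n}. \<forall>k\<in>Vbar N. \<forall>j\<in>Vbar N.
        (\<integral>\<^sup>+\<omega>. ennreal (\<bar>psi_x P N p t \<omega> k j\<bar> ^ 4) \<partial>P) \<le> ennreal C) \<and>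
     (\<integral>\<^sup>+\<omega>. (SUP t\<in>{1..n}. SUP j\<in>Vbar N. SUP k\<in>Vbar N.
        ennreal (\<bar>psi_x P N p t \<omega> k j\<bar> ^ 4)) \<partial>P) \<le> ennreal MPsi \<and>
     (\<forall>\<theta>. meigenvalue (Vbar N) (Psibar P N p) \<theta> \<longrightarrow> \<theta> \<le> K)"

text \<open>
  The constants \<open>c\<close>, \<open>C\<close>, \<open>C'\<close> and the eigenvalue bound \<open>K\<close> are arguments; the remaining arguments
  are sequences indexed by the number of periods.
\<close>

definition regular_design ::
  "real \<Rightarrow> real \<Rightarrow> real \<Rightarrow> real \<Rightarrow> (nat \<Rightarrow> 'w measure) \<Rightarrow> (nat \<Rightarrow> 'v network)
     \<Rightarrow> (nat \<Rightarrow> nat \<Rightarrow> 'w \<Rightarrow> 'v \<Rightarrow> real) \<Rightarrow> (nat \<Rightarrow> nat \<Rightarrow> 'w \<Rightarrow> 'v \<Rightarrow> real)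
     \<Rightarrow> (nat \<Rightarrow> real) \<Rightarrow> (nat \<Rightarrow> real) \<Rightarrow> bool" where
  "regular_design c C C' K P N p \<xi> s r1 \<longleftrightarrow>
     0 < c \<and> c < C \<and> 0 < C' \<and>
     (\<forall>n\<ge>1. sparse_approx (obs (N n)) (Hinv (N n)) (s n) (r1 n)) \<and>
     (\<exists>Meps MPsi :: nat \<Rightarrow> real.
        (\<forall>n\<ge>1. 1 \<le> Meps n \<and> 1 \<le> MPsi n \<and>
           design_data (P n) (N n) n (p n) (\<xi> n) \<and>
           design_noise c C (Meps n) (P n) (N n) n (p n) (\<xi> n) \<and>
           design_covariates c C K (MPsi n) (P n) (N n) n (p n) \<and>
           C' * ln (real (card (obs (N n)))) \<ge> ln (real n)) \<and>
        (\<lambda>n. (s n)\<^sup>2 * ln (real (card (obs (N n)))) * ln (real n) ^ 3) \<in> o(\<lambda>n. real n) \<and>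
        (\<lambda>n. Meps n * MPsi n * ln (real (card (obs (N n))))) \<in> o(\<lambda>n. real n))"


section \<open>Estimators\<close>

text \<open>
  The estimators are defined from a realization \<open>p t\<close>, \<open>y t\<close> of the data in the periods
  \<open>t = 1, \<dots>, n\<close> and the set \<open>I\<close> of observable agents.
\<close>

definition tune_M :: "nat \<Rightarrow> 'v set \<Rightarrow> (nat \<Rightarrow> 'v \<Rightarrow> real) \<Rightarrow> real" where
  "tune_M n I p = sqrt (Max (insert 1 ((\<lambda>k. (\<Sum>t=1..n. (p t k) ^ 4) / real n) ` I)))"

definition tune_tau :: "nat \<Rightarrow> 'v set \<Rightarrow> (nat \<Rightarrow> 'v \<Rightarrow> real) \<Rightarrow> real" where
  "tune_tau n I p = 1 / (4 * tune_M n I p)"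

definition std_normal_quantile :: "real \<Rightarrow> real" where
  "std_normal_quantile = inv (cdf std_normal_distribution)"

definition tune_lambda :: "nat \<Rightarrow> 'v set \<Rightarrow> real" where
  "tune_lambda n I =
     1 / sqrt (real n) * std_normal_quantile (1 - 1 / (3 * real n * (real (card I))\<^sup>2))"

definition resid ::
  "'v set \<Rightarrow> (nat \<Rightarrow> 'v \<Rightarrow> real) \<Rightarrow> (nat \<Rightarrow> 'v \<Rightarrow> real) \<Rightarrow> ('v \<Rightarrow> 'v \<Rightarrow> real) \<Rightarrow> ('v \<Rightarrow> real)
     \<Rightarrow> nat \<Rightarrow> 'v \<Rightarrow> real" where
  "resid I p y W v t k = y t k - (v k - mvec I W (p t) k)"

definition step1_feasible ::
  "nat \<Rightarrow> 'v set \<Rightarrow> (nat \<Rightarrow> 'v \<Rightarrow> real) \<Rightarrow> (nat \<Rightarrow> 'v \<Rightarrow> real)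
     \<Rightarrow> ('v \<Rightarrow> 'v \<Rightarrow> real) \<times> ('v \<Rightarrow> real) \<times> ('v \<Rightarrow> real) \<Rightarrow> bool" where
  "step1_feasible n I p y = (\<lambda>(W, v, z). \<forall>k\<in>I. \<forall>j\<in>insert None (Some ` I).
     \<bar>(\<Sum>t=1..n. resid I p y W v t k * aug (p t) j) / real n\<bar> \<le> tune_lambda n I * z k \<and>
     sqrt ((\<Sum>t=1..n. (resid I p y W v t k)\<^sup>2 * (aug (p t) j)\<^sup>2) / real n) \<le> z k)"

definition step1_objective ::
  "nat \<Rightarrow> 'v set \<Rightarrow> (nat \<Rightarrow> 'v \<Rightarrow> real)
     \<Rightarrow> ('v \<Rightarrow> 'v \<Rightarrow> real) \<times> ('v \<Rightarrow> real) \<times> ('v \<Rightarrow> real) \<Rightarrow> real" where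
  "step1_objective n I p = (\<lambda>(W, v, z).
     \<Sum>k\<in>I. (\<bar>v k\<bar> + (\<Sum>j\<in>I. \<bar>W k j\<bar>)) + tune_tau n I p * z k)"

definition sigma_hat :: "nat \<Rightarrow> (nat \<Rightarrow> 'v \<Rightarrow> real) \<Rightarrow> 'v option \<Rightarrow> 'v option \<Rightarrow> real" where
  "sigma_hat n p k j = (\<Sum>t=1..n. aug (p t) k * aug (p t) j) / real n"

definition step2_feasible ::
  "nat \<Rightarrow> 'v set \<Rightarrow> (nat \<Rightarrow> 'v \<Rightarrow> real)
     \<Rightarrow> ('v option \<Rightarrow> real) \<times> ('v option \<Rightarrow> 'v option \<Rightarrow> real) \<Rightarrow> bool" where
  "step2_feasible n I p = (\<lambda>(z, \<Psi>).
     let J = insert None (Some ` I) in \<forall>k\<in>J. \<forall>j\<in>J.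
       \<bar>mmul J \<Psi> (sigma_hat n p) k j - (if k = j then 1 else 0)\<bar> \<le> tune_lambda n I * z k \<and>
       sqrt ((\<Sum>t=1..n. (mvec J \<Psi> (aug (p t)) k * aug (p t) j - (if k = j then 1 else 0))\<^sup>2) / real n)
         \<le> z k)"

definition step2_objective ::
  "nat \<Rightarrow> 'v set \<Rightarrow> (nat \<Rightarrow> 'v \<Rightarrow> real)
     \<Rightarrow> ('v option \<Rightarrow> real) \<times> ('v option \<Rightarrow> 'v option \<Rightarrow> real) \<Rightarrow> real" where
  "step2_objective n I p = (\<lambda>(z, \<Psi>).
     let J = insert None (Some ` I) in
       \<Sum>k\<in>J. root 4 ((\<Sum>t=1..n. \<bar>mvec J \<Psi> (aug (p t)) k\<bar> ^ 4) / real n) + z k)"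

text \<open>The block matrix with first row \<open>-v\<close> on top of the transpose of \<open>W\<close>.\<close>

definition stack :: "('v \<Rightarrow> real) \<Rightarrow> ('v \<Rightarrow> 'v \<Rightarrow> real) \<Rightarrow> 'v option \<Rightarrow> 'v \<Rightarrow> real" where
  "stack v W l k = (case l of None \<Rightarrow> - v k | Some j \<Rightarrow> W k j)"

text \<open>
  \<open>(v', W')\<close> is a debiased estimator if it arises from some choice of minimizers in the two
  optimization problems.
\<close>

definition debiased_estimator ::
  "nat \<Rightarrow> 'v set \<Rightarrow> (nat \<Rightarrow> 'v \<Rightarrow> real) \<Rightarrow> (nat \<Rightarrow> 'v \<Rightarrow> real)
     \<Rightarrow> ('v \<Rightarrow> real) \<Rightarrow> ('v \<Rightarrow> 'v \<Rightarrow> real) \<Rightarrow> bool" where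
  "debiased_estimator n I p y v' W' \<longleftrightarrow>
     (\<exists>W v z \<Psi> z\<Psi>.
        is_arg_min (step1_objective n I p) (step1_feasible n I p y) (W, v, z) \<and>
        is_arg_min (step2_objective n I p) (step2_feasible n I p) (z\<Psi>, \<Psi>) \<and>
        (\<forall>l\<in>insert None (Some ` I). \<forall>k\<in>I.
           stack v' W' l k = stack v W l k
             - mmul (insert None (Some ` I)) \<Psi>
                 (\<lambda>j k. (\<Sum>t=1..n. aug (p t) j * resid I p y W v t k) / real n) l k))"

definition threshold :: "('v \<Rightarrow> 'v \<Rightarrow> real) \<Rightarrow> ('v \<Rightarrow> 'v \<Rightarrow> real) \<Rightarrow> 'v \<Rightarrow> 'v \<Rightarrow> real" where
  "threshold \<mu> W k j = (if \<bar>W k j\<bar> > \<mu> k j then W k j else 0)"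


section \<open>Asymptotic statements\<close>

text \<open>
  \<open>Q\<close> holds with probability \<open>1 - o(1)\<close>. The event on which it holds is only required to contain a
  measurable one of that probability, since minimizers need not be selected measurably.
\<close>

definition whp :: "(nat \<Rightarrow> 'w measure) \<Rightarrow> (nat \<Rightarrow> 'w \<Rightarrow> bool) \<Rightarrow> bool" where
  "whp P Q \<longleftrightarrow>
     (\<exists>A. (\<forall>n\<ge>1. A n \<in> sets (P n) \<and> (\<forall>\<omega>\<in>A n. Q n \<omega>)) \<and> (\<lambda>n. measure (P n) (A n)) \<longlonglongrightarrow> 1)"

text \<open>
  The hypotheses common to both growth regimes: the network model with its standing assumptions, the
  well-conditioned diagonalizations, the debiased estimator \<open>(vc, Wc)\<close>, and the thresholds \<open>\<mu>\<close>.
  The thresholds may depend on the data; since the estimation error is random, the inequalities they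
  satisfy are assumed with probability \<open>1 - o(1)\<close>, which includes the case that they always hold.
\<close>

definition setting ::
  "real \<Rightarrow> real \<Rightarrow> real \<Rightarrow> real \<Rightarrow> real \<Rightarrow> real \<Rightarrow> (nat \<Rightarrow> 'w measure) \<Rightarrow> (nat \<Rightarrow> 'v network)
     \<Rightarrow> (nat \<Rightarrow> nat \<Rightarrow> 'w \<Rightarrow> 'v \<Rightarrow> real) \<Rightarrow> (nat \<Rightarrow> nat \<Rightarrow> 'w \<Rightarrow> 'v \<Rightarrow> real)
     \<Rightarrow> (nat \<Rightarrow> 'w \<Rightarrow> 'v \<Rightarrow> real) \<Rightarrow> (nat \<Rightarrow> 'w \<Rightarrow> 'v \<Rightarrow> 'v \<Rightarrow> real)
     \<Rightarrow> (nat \<Rightarrow> 'w \<Rightarrow> 'v \<Rightarrow> 'v \<Rightarrow> real) \<Rightarrow> bool" where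
  "setting abar lambar pbar \<zeta> \<kappa>bar C1 P N p \<xi> vc Wc \<mu> \<longleftrightarrow>
     (\<forall>n\<ge>1. network_ok abar lambar \<zeta> (N n) \<and> model pbar (P n) (N n) n (p n) (\<xi> n) \<and>
        diagonalizable_cond (agents (N n)) (Mmat (N n)) \<kappa>bar \<and>
        diagonalizable_cond (lat (N n)) (Mmat (N n)) \<kappa>bar \<and>
        (\<forall>\<omega>\<in>space (P n).
           debiased_estimator n (obs (N n)) (\<lambda>t. p n t \<omega>)
             (\<lambda>t. outcome (N n) (p n t \<omega>) (\<xi> n t \<omega>)) (vc n \<omega>) (Wc n \<omega>))) \<and>
     whp P (\<lambda>n \<omega>. \<forall>k\<in>obs (N n). \<forall>j\<in>obs (N n).
        2 * \<bar>Wc n \<omega> k j - Hinv (N n) k j\<bar> \<le> \<mu> n \<omega> k j \<and>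
        \<mu> n \<omega> k j \<le> C1 * sqrt (ln (real (card (obs (N n)))) / real n))"

definition max_error ::
  "'v network \<Rightarrow> ('v \<Rightarrow> 'v \<Rightarrow> real) \<Rightarrow> ('v \<Rightarrow> 'v \<Rightarrow> real) \<Rightarrow> real" where
  "max_error N \<mu> W =
     max (mnorm_inf (obs N) (\<lambda>k j. threshold \<mu> W k j - Hinv N k j))
         (mnorm_1 (obs N) (\<lambda>k j. threshold \<mu> W k j - Hinv N k j))"

end

theory Submission
  imports Defs
begin

text \<open>
  An entry of the thresholded estimator is off by at most \<open>min (3\<mu>/2) \<bar>h\<bar>\<close>, where \<open>h\<close> is the true
  entry. In each row and column the first bound is used on the at most \<open>s\<close> nonzero positions of the
  sparse approximant, and the second one elsewhere, where the true entry equals the approximation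
  error. This gives \<open>3 / 2 * s * max \<mu> + r1\<close> for both norms.
\<close>

lemma threshold_error:
  assumes "2 * \<bar>W k j - h\<bar> \<le> \<mu> k j"
  shows "\<bar>threshold \<mu> W k j - h\<bar> \<le> 3 / 2 * \<mu> k j" and "\<bar>threshold \<mu> W k j - h\<bar> \<le> \<bar>h\<bar>"
  \<comment> \<open>A kept entry has error at most \<open>\<mu> k j / 2\<close>, and
    \<open>\<bar>W k j\<bar> > \<mu> k j\<close> then forces
    \<open>\<bar>h\<bar> > \<mu> k j / 2\<close>. A dropped entry has error exactly
    \<open>\<bar>h\<bar>\<close>, and
    \<open>\<bar>h\<bar> \<le> \<bar>W k j\<bar> + \<mu> k j / 2\<close>.\<close>
  using assms by (simp_all add: threshold_def abs_if split: if_splits)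

text \<open>Formulated for a single vector so that it serves rows and columns alike:
  \<open>e\<close> is the error, \<open>h\<close> the truth and \<open>w\<close> the sparse
  approximant.\<close>

lemma sum_abs_le_sparse:
  fixes e h w :: "'j \<Rightarrow> real"
  assumes "finite I" and "0 \<le> b"
    and "\<And>j. j \<in> I \<Longrightarrow> \<bar>e j\<bar> \<le> b" and eh: "\<And>j. j \<in> I \<Longrightarrow> \<bar>e j\<bar> \<le> \<bar>h j\<bar>"
    and card: "real (card {j\<in>I. w j \<noteq> 0}) \<le> s"
    and r1: "(\<Sum>j\<in>I. \<bar>h j - w j\<bar>) \<le> r1"
  shows "(\<Sum>j\<in>I. \<bar>e j\<bar>) \<le> s * b + r1"
proof -
  have "\<bar>e j\<bar> \<le> (if w j \<noteq> 0 then b else 0) + \<bar>h j - w j\<bar>" if "j \<in> I" for j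
    using assms(3)[OF that] eh[OF that] by auto
  then have "(\<Sum>j\<in>I. \<bar>e j\<bar>) \<le> (\<Sum>j\<in>I. (if w j \<noteq> 0 then b else 0) + \<bar>h j - w j\<bar>)"
    by (rule sum_mono)
  also have "\<dots> = real (card {j\<in>I. w j \<noteq> 0}) * b + (\<Sum>j\<in>I. \<bar>h j - w j\<bar>)"
    using assms(1) by (simp add: sum.distrib sum.If_cases Int_def)
  also have "\<dots> \<le> s * b + r1"
    using mult_right_mono[OF card \<open>0 \<le> b\<close>] r1 by linarith
  finally show ?thesis .
qed

text \<open>The \<open>0\<close> inserted in the maximum turns into the condition
  \<open>0 \<le> b\<close>, so the equivalence also covers an empty carrier.\<close>

lemma mnorm_1_le_iff:
  "finite I \<Longrightarrow> mnorm_1 I A \<le> b \<longleftrightarrow> 0 \<le> b \<and> (\<forall>j\<in>I. (\<Sum>i\<in>I. \<bar>A i j\<bar>) \<le> b)"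
  by (simp add: mnorm_1_def)

lemma mnorm_inf_le_iff:
  "finite I \<Longrightarrow> mnorm_inf I A \<le> b \<longleftrightarrow> 0 \<le> b \<and> (\<forall>i\<in>I. (\<Sum>j\<in>I. \<bar>A i j\<bar>) \<le> b)"
  by (simp add: mnorm_inf_def)

lemma max_error_le:
  assumes fin: "finite (obs N)" and sp: "sparse_approx (obs N) (Hinv N) s r1"
    and "0 \<le> s" and "0 \<le> b"
    and \<mu>: "\<And>k j. k \<in> obs N \<Longrightarrow> j \<in> obs N \<Longrightarrow> 2 * \<bar>W k j - Hinv N k j\<bar> \<le> \<mu> k j \<and> \<mu> k j \<le> b"
  shows "max_error N \<mu> W \<le> s * (3 / 2 * b) + r1"
proof -
  obtain V where V: "sparse_mat (obs N) s V"
    and n1: "mnorm_1 (obs N) (\<lambda>i j. Hinv N i j - V i j) \<le> r1"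
    and ninf: "mnorm_inf (obs N) (\<lambda>i j. Hinv N i j - V i j) \<le> r1"
    using sp by (auto simp: sparse_approx_def)
  have e: "\<bar>threshold \<mu> W k j - Hinv N k j\<bar> \<le> 3 / 2 * b"
          "\<bar>threshold \<mu> W k j - Hinv N k j\<bar> \<le> \<bar>Hinv N k j\<bar>"
    if "k \<in> obs N" "j \<in> obs N" for k j
    using threshold_error[of W k j "Hinv N k j" \<mu>] \<mu>[OF that] by auto
  have b: "0 \<le> 3 / 2 * b"
    using \<open>0 \<le> b\<close> by simp
  \<comment> \<open>A bound on the norms must itself be nonnegative; \<open>0 \<le> r1\<close> is
    read off from \<open>n1\<close>.\<close>
  have "0 \<le> s * (3 / 2 * b) + r1"
    using n1 fin b \<open>0 \<le> s\<close> by (simp add: mnorm_1_le_iff)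
  moreover have "(\<Sum>j\<in>obs N. \<bar>threshold \<mu> W k j - Hinv N k j\<bar>) \<le> s * (3 / 2 * b) + r1"
    if "k \<in> obs N" for k
    using that V ninf e fin
    by (intro sum_abs_le_sparse[where h = "Hinv N k" and w = "V k", OF fin b])
       (auto simp: sparse_mat_def mnorm_inf_le_iff)
  moreover have "(\<Sum>k\<in>obs N. \<bar>threshold \<mu> W k j - Hinv N k j\<bar>) \<le> s * (3 / 2 * b) + r1"
    if "j \<in> obs N" for j
    using that V n1 e fin
    by (intro sum_abs_le_sparse[where h = "\<lambda>k. Hinv N k j" and w = "\<lambda>k. V k j", OF fin b])
       (auto simp: sparse_mat_def mnorm_1_le_iff)
  ultimately show ?thesis
    using fin by (simp add: max_error_def mnorm_1_le_iff mnorm_inf_le_iff)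
qed

text \<open>The measurable events that witness the hypothesis also witness the conclusion, so a
  pointwise implication suffices.\<close>

lemma whp_mono:
  assumes "whp P Q" and "\<And>n \<omega>. n \<ge> 1 \<Longrightarrow> Q n \<omega> \<Longrightarrow> R n \<omega>"
  shows "whp P R"
  using assms unfolding whp_def by meson

text \<open>The sign of \<open>C1\<close> is unrestricted, and the resulting constant has to be positive.\<close>

lemma whp_max_error:
  assumes set: "setting abar lambar pbar \<zeta> \<kappa>bar C1 P N p \<xi> vc Wc \<mu>"
    and reg: "regular_design c C C' K P N p \<xi> s r1"
    and s: "\<And>n. 0 \<le> s n"
    and bnd: "\<And>n. n \<ge> 1 \<Longrightarrow>
       3 / 2 * (\<bar>C1\<bar> + 1) * (s n * sqrt (ln (real (card (obs (N n)))) / real n)) + r1 n \<le> f n"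
  shows "whp P (\<lambda>n \<omega>. max_error (N n) (\<mu> n \<omega>) (Wc n \<omega>) \<le> f n)"
proof (rule whp_mono)
  show "whp P (\<lambda>n \<omega>. \<forall>k\<in>obs (N n). \<forall>j\<in>obs (N n).
        2 * \<bar>Wc n \<omega> k j - Hinv (N n) k j\<bar> \<le> \<mu> n \<omega> k j \<and>
        \<mu> n \<omega> k j \<le> C1 * sqrt (ln (real (card (obs (N n)))) / real n))"
    using set unfolding setting_def by (elim conjE)
next
  \<comment> \<open>From here on the threshold inequalities hold at the fixed sample point, and the
    argument is deterministic.\<close>
  fix n \<omega>
  define \<delta> where "\<delta> = sqrt (ln (real (card (obs (N n)))) / real n)"
  assume n: "n \<ge> 1" and "\<forall>k\<in>obs (N n). \<forall>j\<in>obs (N n).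
        2 * \<bar>Wc n \<omega> k j - Hinv (N n) k j\<bar> \<le> \<mu> n \<omega> k j \<and>
        \<mu> n \<omega> k j \<le> C1 * sqrt (ln (real (card (obs (N n)))) / real n)"
  then have \<mu>: "2 * \<bar>Wc n \<omega> k j - Hinv (N n) k j\<bar> \<le> \<mu> n \<omega> k j \<and> \<mu> n \<omega> k j \<le> C1 * \<delta>"
    if "k \<in> obs (N n)" "j \<in> obs (N n)" for k j
    using that by (auto simp: \<delta>_def)
  \<comment> \<open>Either some agent is observed, so that the cardinality is at least 1, or the
    default value \<open>ln 0 = 0\<close> applies.\<close>
  have "0 \<le> ln (real (card (obs (N n))))"
    by (cases "card (obs (N n)) = 0") auto
  then have \<delta>: "0 \<le> \<delta>"
    by (simp add: \<delta>_def)
  then have "C1 * \<delta> \<le> (\<bar>C1\<bar> + 1) * \<delta>"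
    by (intro mult_right_mono) auto
  then have \<mu>': "2 * \<bar>Wc n \<omega> k j - Hinv (N n) k j\<bar> \<le> \<mu> n \<omega> k j \<and> \<mu> n \<omega> k j \<le> (\<bar>C1\<bar> + 1) * \<delta>"
    if "k \<in> obs (N n)" "j \<in> obs (N n)" for k j
    using \<mu>[OF that] by linarith
  have fin: "finite (obs (N n))"
    using set n by (auto simp: setting_def network_ok_def agents_def)
  have "sparse_approx (obs (N n)) (Hinv (N n)) (s n) (r1 n)"
    using reg n by (auto simp: regular_design_def)
  then have "max_error (N n) (\<mu> n \<omega>) (Wc n \<omega>) \<le> s n * (3 / 2 * ((\<bar>C1\<bar> + 1) * \<delta>)) + r1 n"
    using fin s \<delta> \<mu>' by (intro max_error_le) auto
  also have "\<dots> \<le> f n"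
    using bnd[OF n] by (simp add: \<delta>_def field_simps)
  finally show "max_error (N n) (\<mu> n \<omega>) (Wc n \<omega>) \<le> f n" .
qed

text \<open>Rate arithmetic of the polynomial regime: with \<open>x\<close> the ratio of the
  log-dimension to \<open>n\<close>, the sparsity scales as the power -1/4 of \<open>x\<close> and
  the thresholds as its square root.\<close>

lemma powr_inverse_mult_sqrt:
  fixes x :: real
  assumes "0 \<le> x"
  shows "inverse x powr (1 / 4) * sqrt x = root 4 x"
proof (cases "x = 0")
  case False
  then have "inverse x powr (1 / 4) * sqrt x = x powr (- (1 / 4)) * x powr (1 / 2)"
    using assms by (simp add: powr_minus powr_half_sqrt powr_divide inverse_eq_divide)
  also have "\<dots> = root 4 x"
    using assms False by (simp add: powr_add[symmetric] root_powr_inverse)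
  finally show ?thesis .
\<comment> \<open>At \<open>x = 0\<close> both sides vanish.\<close>
qed simp

theorem corollary3:
  fixes abar lambar pbar \<zeta> \<kappa>bar C1 c C C' K r q :: real
  assumes "0 < \<zeta>" and "\<zeta> < lambar"
    and "r = (2 * lambar - \<zeta>) / \<zeta>"
    and "q = (sqrt r - 1) / (sqrt r + 1)"
  shows
    "(\<forall>Ce>0. \<forall>de>0. \<forall>Ct1>0. \<forall>Ct2>0. \<forall>\<nu>. \<nu> = log (de / q) de \<longrightarrow>
       (\<exists>Ct5>0. \<exists>Ct6>0.
         \<forall>(P :: nat \<Rightarrow> 'w measure) (N :: nat \<Rightarrow> 'v network) p \<xi> vc Wc \<mu>.
           setting abar lambar pbar \<zeta> \<kappa>bar C1 P N p \<xi> vc Wc \<mu> \<and>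
           (\<forall>n\<ge>1. exp_growth Ce de (N n)) \<and>
           regular_design c C C' K P N p \<xi>
             (\<lambda>n. Ct1 * (sqrt (real n * real (card (obs (N n)))) / ln (real (card (obs (N n))))) powr \<nu>)
             (\<lambda>n. Ct2 * real (card (obs (N n))) powr (\<nu> / 2)
                    * (ln (real (card (obs (N n)))) / sqrt (real n)) powr (1 - \<nu>)) \<longrightarrow>
           whp P (\<lambda>n \<omega>. max_error (N n) (\<mu> n \<omega>) (Wc n \<omega>)
             \<le> Ct5 * sqrt (ln (real (card (obs (N n)))) / real n)
                  * (sqrt (real n * real (card (obs (N n)))) / ln (real (card (obs (N n))))) powr \<nu>
               + Ct6 * real (card (obs (N n))) powr (\<nu> / 2)
                  * (ln (real (card (obs (N n)))) / sqrt (real n)) powr (1 - \<nu>))))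
     \<and>
     (\<forall>Cp>0. \<forall>dp>0. \<forall>Ct3>0. \<forall>Ct4>0.
       (\<exists>Ct7>0. \<exists>Ct8>0.
         \<forall>(P :: nat \<Rightarrow> 'w measure) (N :: nat \<Rightarrow> 'v network) p \<xi> vc Wc \<mu>.
           setting abar lambar pbar \<zeta> \<kappa>bar C1 P N p \<xi> vc Wc \<mu> \<and>
           (\<forall>n\<ge>1. poly_growth Cp dp (N n)) \<and>
           regular_design c C C' K P N p \<xi>
             (\<lambda>n. Ct3 * (real n / ln (real (card (obs (N n))))) powr (1 / 4))
             (\<lambda>n. Ct4 * sqrt (real (card (obs (N n))))
                    * q powr ((real n / ln (real (card (obs (N n))))) powr (1 / (4 * dp)))) \<longrightarrow>
           whp P (\<lambda>n \<omega>. max_error (N n) (\<mu> n \<omega>) (Wc n \<omega>)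
             \<le> Ct7 * root 4 (ln (real (card (obs (N n)))) / real n)
               + Ct8 * sqrt (real (card (obs (N n))))
                  * q powr ((real n / ln (real (card (obs (N n))))) powr (1 / (4 * dp))))))"
proof (intro conjI allI impI, goal_cases)
  case (1 Ce de Ct1 Ct2 \<nu>)
  \<comment> \<open>The first constant collects the factor 3/2 of the entrywise error, the enlarged
    threshold constant and the constant of the sparsity. The approximation error enters with
    coefficient 1 and keeps its constant \<open>Ct2\<close>.\<close>
  then show ?case
    by (intro exI[of _ "3 / 2 * (\<bar>C1\<bar> + 1) * Ct1"] exI[of _ Ct2] conjI allI impI; (elim conjE)?)
       (auto intro!: whp_max_error simp: mult_ac)
next
  case (2 Cp dp Ct3 Ct4)
  \<comment> \<open>The ratio in the sparsity is the inverse of the one in the thresholds, so their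
    product collapses to a fourth root.\<close>
  have root4: "(real n / ln (real m)) powr (1 / 4) * sqrt (ln (real m) / real n)
      = root 4 (ln (real m) / real n)" for n m :: nat
  proof -
    have "0 \<le> ln (real m)"
      by (cases "m = 0") auto
    then show ?thesis
      using powr_inverse_mult_sqrt[of "ln (real m) / real n"] by simp
  qed
  show ?case
    using 2
    by (intro exI[of _ "3 / 2 * (\<bar>C1\<bar> + 1) * Ct3"] exI[of _ Ct4] conjI allI impI; (elim conjE)?)
       (auto intro!: whp_max_error simp: mult.assoc root4)
qed

end
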